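(* The following two statements are equivalent: (i) There exists a constant $C>1$ such that $M(P)\ge C$ for all noncyclotomic monic polynomials $P\in\mathbb{Z}[x]$. (ii) There exists a constant $C>1$ such that $\limsup_{n\to\infty}|\Delta(P_n)|^{\frac{1}{nd}}\ge C$ for all noncyclotomic monic polynomials $P\in\mathbb{Z}[x]$ without multiple roots, where $d=\deg P$.
   Context: For a monic polynomial $P$ of degree $d$ with roots $\alpha_1,\dots,\alpha_d$ (with multiplicity), $M(P)=\prod_{j=1}^d\max\{1,|\alpha_j|\}$ is its Mahler measure, $P_n(x):=\prod_{j=1}^d(x-\alpha_j^n)\in\mathbb{Z}[x]$ for $n\ge1$, and $\Delta(P_n)=\prod_{1\le j<k\le d}(\alpha_j^n-\alpha_k^n)^2$ is the discriminant of $P_n$. A polynomial is called cyclotomic if it is a product of cyclotomic polynomials (equivalently, all its roots are roots of unity); noncyclotomic means not cyclotomic. Throughout, polynomials are monic.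
   Formalization: Here noncyclotomic means not a power of x times a product of cyclotomic polynomials (P = x has M(P) = 1), and (ii) is restricted to deg P ≥ 2, since for P = x − 2 the discriminant is the empty product 1 and (ii) would fail. *)

theory Defs
  imports
    "HOL-Analysis.Analysis"
    "Berlekamp_Zassenhaus.Mahler_Measure"
begin

text \<open>
  The complex roots of \<open>p\<close>, listed with multiplicity, are \<^const>\<open>complex_roots_complex\<close>, and
  \<^const>\<open>mahler_measure\<close> is the Mahler measure of an integer polynomial. For monic \<open>p\<close> the leading
  coefficient in the latter is 1.
\<close>

definition cyclotomic_poly :: "nat \<Rightarrow> complex poly" where
  "cyclotomic_poly n = (\<Prod>z | z ^ n = 1 \<and> (\<forall>m\<in>{1..<n}. z ^ m \<noteq> 1). [:- z, 1:])"

definition cyclotomic :: "int poly \<Rightarrow> bool" where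
  "cyclotomic P \<longleftrightarrow>
     (\<exists>ns. (\<forall>n\<in>set ns. n \<ge> 1) \<and> map_poly of_int P = (\<Prod>n\<leftarrow>ns. cyclotomic_poly n))"

text \<open>
  Factors \<open>x\<close> are disregarded, as usual in the context of Lehmer's problem: \<open>x\<^sup>k\<close> times a cyclotomic
  polynomial has Mahler measure 1, so it has to be excluded for the existence of a lower bound
  \<open>C > 1\<close> to be an open question rather than trivially false. Products of \<open>x\<^sup>k\<close> with other
  polynomials remain noncyclotomic.
\<close>

definition noncyclotomic :: "int poly \<Rightarrow> bool" where
  "noncyclotomic P \<longleftrightarrow> \<not> (\<exists>k Q. cyclotomic Q \<and> P = [:0, 1:] ^ k * Q)"

definition power_roots_poly :: "int poly \<Rightarrow> nat \<Rightarrow> complex poly" where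
  "power_roots_poly P n = (\<Prod>\<alpha>\<leftarrow>complex_roots_int P. [:- (\<alpha> ^ n), 1:])"

text \<open>
  The discriminant of a monic polynomial. The product does not depend on the order of the roots.
  It is empty, hence 1, for a linear polynomial such as \<open>x - 2\<close>, so that lower bounds \<open>C > 1\<close> on
  discriminants make sense only from degree 2 on.
\<close>

definition monic_discriminant :: "complex poly \<Rightarrow> complex" where
  "monic_discriminant p =
     (let \<beta> = complex_roots_complex p
      in \<Prod>k<length \<beta>. \<Prod>j<k. (\<beta> ! j - \<beta> ! k)\<^sup>2)"

end

theory Submission
  imports Defs "Berlekamp_Zassenhaus.Square_Free_Int_To_Square_Free_GFp"
begin

text \<open>
  For \<open>P\<close> of degree \<open>d\<close> with distinct roots, the upper limit in question lies between
  \<open>M(P) powr ((d - 1) / d)\<close> and \<open>M(P)\<^sup>2\<close>, so lower bounds for it and for \<open>M(P)\<close> imply each other.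
  The upper bound follows factor by factor from the triangle inequality. For the lower bound,
  simultaneous Dirichlet approximation yields infinitely many \<open>n\<close> for which every
  \<open>\<bar>\<alpha>\<^sub>j\<^sup>n - \<alpha>\<^sub>k\<^sup>n\<bar>\<close> is at least a constant times \<open>max(\<bar>\<alpha>\<^sub>j\<bar>, \<bar>\<alpha>\<^sub>k\<bar>)\<^sup>n\<close>; if no root vanishes, then
  for fixed \<open>j\<close> the product of these maxima over all \<open>k\<close> is at least \<open>\<bar>\<alpha>\<^sub>j\<bar>\<^sup>d\<close> and at least the product
  of all \<open>\<bar>\<alpha>\<^sub>k\<bar>\<close>, which is a positive integer, hence at least \<open>max(1, \<bar>\<alpha>\<^sub>j\<bar>)\<^sup>d\<close>. Polynomials with
  multiple roots are reduced to an irreducible noncyclotomic factor; if that factor is linear, then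
  it is \<open>x - a\<close> with \<open>\<bar>a\<bar> \<ge> 2\<close>.
\<close>

section \<open>Recurrence of powers\<close>

lemma norm_cis_minus_one_le: "norm (cis t - 1) \<le> \<bar>t\<bar>"
proof -
  have "norm (cis t - 1) = 2 * \<bar>sin (t / 2)\<bar>"
    using dist_exp_i_1[of t] by (simp add: cis_conv_exp)
  also have "\<dots> \<le> \<bar>t\<bar>"
    using abs_sin_x_le_abs_x[of "t / 2"] by simp
  finally show ?thesis .
qed

text \<open>Dirichlet approximation brings a common multiple of all arguments, measured in full
  turns, close to integers. An error of at most \<open>1 / N\<close> of a turn moves a point of the
  circle by at most \<open>2 * pi / N\<close>, which the choice of \<open>N\<close> keeps below
  \<open>\<epsilon>\<close>.\<close>

lemma unimodular_powers_recurrent: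
  fixes U :: "complex set"
  assumes U: "finite U" "\<And>z. z \<in> U \<Longrightarrow> norm z = 1" and "\<epsilon> > 0"
  shows "\<exists>q\<ge>B. \<forall>z\<in>U. norm (z ^ q - 1) < \<epsilon>"
proof -
  obtain h where h: "bij_betw h {..<card U} U"
    using ex_bij_betw_nat_finite[OF U(1)] by (auto simp: atLeast0LessThan)
  \<comment> \<open>Dirichlet only promises some \<open>k > 0\<close>. Scaling the arguments by
    \<open>B + 1\<close> turns the exponent into a positive multiple of \<open>B + 1\<close>, hence
    makes it large enough.\<close>
  define \<theta> where "\<theta> = (\<lambda>i. real (B + 1) * (Arg (h i) / (2 * pi)))"
  obtain N :: nat where N: "2 * pi / \<epsilon> < N"
    using reals_Archimedean2 by blast
  moreover have "2 * pi / \<epsilon> > 0"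
    using \<open>\<epsilon> > 0\<close> by simp
  ultimately have "real N > 0"
    by (rule less_trans[rotated])
  hence "N > 0" by simp
  obtain k p where k: "k > 0" and kp: "\<And>i. i < card U \<Longrightarrow> \<bar>of_int k * \<theta> i - of_int (p i)\<bar> < 1 / N"
    using Dirichlet_approx_simult[OF \<open>N > 0\<close>, of "card U" \<theta>] by metis
  define q where "q = (B + 1) * nat k"
  have "q \<ge> (B + 1) * 1"
    unfolding q_def using k by (intro mult_le_mono) auto
  moreover have "norm (z ^ q - 1) < \<epsilon>" if "z \<in> U" for z
  proof -
    have "z \<in> h ` {..<card U}"
      using h that by (simp add: bij_betw_def)
    then obtain i where i: "i < card U" "z = h i"
      by auto
    have "z = cis (Arg z)"
      using U(2)[OF that] rcis_cmod_Arg[of z] by (simp add: rcis_def)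
    hence "z ^ q = cis (Arg z) ^ q"
      by (rule arg_cong)
    also have "\<dots> = cis (real q * Arg z)"
      by (rule Complex.DeMoivre)
    also have "real q * Arg z = 2 * pi * (of_int k * \<theta> i - of_int (p i)) + 2 * pi * of_int (p i)"
      using k by (simp add: q_def \<theta>_def i field_simps)
    also have "cis \<dots> = cis (2 * pi * (of_int k * \<theta> i - of_int (p i)))"
      by (simp flip: cis_mult)
    finally have "norm (z ^ q - 1) \<le> \<bar>2 * pi * (of_int k * \<theta> i - of_int (p i))\<bar>"
      using norm_cis_minus_one_le by simp
    also have "\<dots> = 2 * pi * \<bar>of_int k * \<theta> i - of_int (p i)\<bar>"
      by (simp add: abs_mult)
    also have "\<dots> \<le> 2 * pi * (1 / N)"
      using kp[OF i(1)] by (intro mult_left_mono) auto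
    also have "\<dots> < \<epsilon>"
      using N \<open>N > 0\<close> \<open>\<epsilon> > 0\<close> by (simp add: field_simps)
    finally show ?thesis .
  qed
  ultimately show ?thesis by (intro exI[of _ q]) auto
qed

lemma powers_avoid_one:
  fixes Z :: "complex set"
  assumes Z: "finite Z" "\<And>z. z \<in> Z \<Longrightarrow> norm z \<le> 1 \<and> z \<noteq> 1"
  shows "\<exists>c>0. \<forall>B. \<exists>n\<ge>B. \<forall>z\<in>Z. norm (1 - z ^ n) \<ge> c"
proof -
  \<comment> \<open>Inside the disc, \<open>1 - norm z\<close> bounds the distance of every positive
    power of \<open>z\<close> from 1. On the circle, half of the distance from \<open>z\<close> to 1
    is reserved for the recurrence error and the other half remains as the bound.\<close>
  define f where "f z = (if norm z = 1 then norm (1 - z) / 2 else 1 - norm z)" for z :: complex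
  \<comment> \<open>Inserting 1 keeps \<open>Min\<close> meaningful when \<open>Z\<close> is
    empty.\<close>
  define c where "c = Min (insert 1 (f ` Z))"
  have c_le: "c \<le> f z" if "z \<in> Z" for z
    unfolding c_def using Z(1) that by (intro Min_le) auto
  have f_pos: "f z > 0" if "z \<in> Z" for z
    using Z(2)[OF that] by (auto simp: f_def)
  have "c > 0"
    unfolding c_def using Z(1) f_pos by (subst Min_gr_iff) auto
  moreover have "\<exists>n\<ge>B. \<forall>z\<in>Z. norm (1 - z ^ n) \<ge> c" for B
  proof -
    define U where "U = {z\<in>Z. norm z = 1}"
    have "finite U" "\<And>z. z \<in> U \<Longrightarrow> norm z = 1"
      using Z(1) by (auto simp: U_def)
    then obtain q where q: "q \<ge> B" "\<And>z. z \<in> U \<Longrightarrow> norm (z ^ q - 1) < c"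
      using unimodular_powers_recurrent[of U c B] \<open>c > 0\<close> by blast
    have "norm (1 - z ^ Suc q) \<ge> c" if z: "z \<in> Z" for z
    proof (cases "norm z = 1")
      case True
      \<comment> \<open>\<open>z ^ q\<close> is close to 1, so \<open>z ^ Suc q\<close> is close to \<open>z\<close> and hence away from 1.\<close>
      have "norm (z - z ^ Suc q) = norm z * norm (z ^ q - 1)"
        by (subst norm_mult[symmetric], subst norm_minus_commute) (simp add: algebra_simps)
      also have "\<dots> \<le> f z"
        using q(2)[of z] c_le[OF z] True z by (simp add: U_def)
      finally have "norm (z - z ^ Suc q) \<le> f z" .
      moreover have "norm (1 - z) \<le> norm (1 - z ^ Suc q) + norm (z - z ^ Suc q)"
        using norm_triangle_ineq4[of "1 - z ^ Suc q" "z - z ^ Suc q"] by simp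
      ultimately show ?thesis
        using c_le[OF z] True by (simp add: f_def)
    next
      case False
      have "norm (z ^ Suc q) \<le> norm z"
        using Z(2)[OF z] by (simp add: norm_mult norm_power mult_left_le power_le_one)
      moreover have "1 - norm (z ^ Suc q) \<le> norm (1 - z ^ Suc q)"
        using norm_triangle_ineq2[of 1 "z ^ Suc q"] by simp
      ultimately show ?thesis
        using c_le[OF z] False by (simp add: f_def)
    qed
    thus ?thesis using q(1) by (intro exI[of _ "Suc q"]) auto
  qed
  ultimately show ?thesis by blast
qed

text \<open>Dividing by the element of larger modulus, say \<open>a\<close>, reduces the claim to
  \<open>1 - (b / a) ^ n\<close>, where \<open>b / a\<close> lies in the closed unit disc and
  differs from 1. Only finitely many quotients occur, so one \<open>n\<close> serves all
  pairs.\<close>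

lemma power_differences_bounded_below:
  fixes A :: "complex set"
  assumes A: "finite A"
  shows "\<exists>c>0. \<forall>B. \<exists>n\<ge>B. \<forall>a\<in>A. \<forall>b\<in>A - {a}. norm (a ^ n - b ^ n) \<ge> c * max (norm a) (norm b) ^ n"
proof -
  define Z where "Z = {z \<in> (\<lambda>(a, b). b / a) ` (A \<times> A). norm z \<le> 1 \<and> z \<noteq> 1}"
  have "finite Z" "\<And>z. z \<in> Z \<Longrightarrow> norm z \<le> 1 \<and> z \<noteq> 1"
    using A by (auto simp: Z_def)
  then obtain c where c: "c > 0" "\<And>B. \<exists>n\<ge>B. \<forall>z\<in>Z. norm (1 - z ^ n) \<ge> c"
    using powers_avoid_one[of Z] by blast
  have main: "norm (a ^ n - b ^ n) \<ge> c * norm a ^ n"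
    if "\<forall>z\<in>Z. norm (1 - z ^ n) \<ge> c" "a \<in> A" "b \<in> A" "a \<noteq> b" "norm b \<le> norm a" for a b n
  proof -
    have "a \<noteq> 0" using that by auto
    hence "b / a \<in> Z"
      using that by (auto simp: Z_def norm_divide divide_le_eq_1 intro!: image_eqI[of _ _ "(a, b)"])
    have "c * norm a ^ n \<le> norm (1 - (b / a) ^ n) * norm (a ^ n)"
      using that \<open>b / a \<in> Z\<close> by (auto simp: norm_power intro!: mult_right_mono)
    also have "\<dots> = norm (a ^ n - b ^ n)"
      using \<open>a \<noteq> 0\<close> by (simp flip: norm_mult add: algebra_simps power_divide)
    finally show ?thesis .
  qed
  have "\<exists>n\<ge>B. \<forall>a\<in>A. \<forall>b\<in>A - {a}. norm (a ^ n - b ^ n) \<ge> c * max (norm a) (norm b) ^ n" for B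
  proof -
    obtain n where n: "n \<ge> B" "\<forall>z\<in>Z. norm (1 - z ^ n) \<ge> c"
      using c(2) by blast
    have "norm (a ^ n - b ^ n) \<ge> c * max (norm a) (norm b) ^ n" if "a \<in> A" "b \<in> A - {a}" for a b
      using main[OF n(2), of a b] main[OF n(2), of b a] that
      by (cases "norm b \<le> norm a") (auto simp: norm_minus_commute max_def)
    thus ?thesis using n(1) by blast
  qed
  thus ?thesis using c(1) by blast
qed

section \<open>Products over pairs of roots\<close>

text \<open>The product runs over ordered pairs of distinct elements. Every unordered pair thus
  occurs twice, which accounts for the square in the discriminant, and no enumeration of the roots
  is involved.\<close>

definition pair_prod :: "(complex \<Rightarrow> complex \<Rightarrow> real) \<Rightarrow> complex set \<Rightarrow> real" where
  "pair_prod f A = (\<Prod>a\<in>A. \<Prod>b\<in>A - {a}. f a b)"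

lemma pair_prod_mono:
  assumes "\<And>a b. a \<in> A \<Longrightarrow> b \<in> A \<Longrightarrow> a \<noteq> b \<Longrightarrow> 0 \<le> f a b \<and> f a b \<le> g a b"
  shows "pair_prod f A \<le> pair_prod g A"
  unfolding pair_prod_def using assms by (intro prod_mono conjI prod_nonneg) auto

lemma pair_prod_mult: "pair_prod (\<lambda>a b. f a b * g a b) A = pair_prod f A * pair_prod g A"
  by (simp add: pair_prod_def prod.distrib)

lemma pair_prod_power: "pair_prod (\<lambda>a b. f a b ^ n) A = pair_prod f A ^ n"
  by (simp add: pair_prod_def prod_power_distrib)

lemma pair_prod_const:
  assumes "finite A"
  shows "pair_prod (\<lambda>a b. c) A = c ^ (card A * (card A - 1))"
proof -
  have "pair_prod (\<lambda>a b. c) A = (\<Prod>a\<in>A. c ^ (card A - 1))"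
    unfolding pair_prod_def using assms by (intro prod.cong) auto
  thus ?thesis by (simp flip: power_mult add: mult.commute)
qed

text \<open>With \<open>g a\<close> and \<open>g b\<close> at least 1, the sum
  \<open>g a + g b\<close> is at most twice their product, so the bound becomes multiplicative and
  each root can be collected separately.\<close>

lemma pair_prod_power_differences_le:
  assumes A: "finite A"
  shows "pair_prod (\<lambda>a b. norm (a ^ n - b ^ n)) A
           \<le> 2 ^ (card A)\<^sup>2 * (\<Prod>a\<in>A. max 1 (norm a)) ^ (2 * n * card A)"
proof -
  define g where "g = (\<lambda>a::complex. max 1 (norm a) ^ n)"
  have g: "g a \<ge> 1" "norm (a ^ n) \<le> g a" for a
    by (auto simp: g_def norm_power intro!: power_mono)
  have le: "norm (a ^ n - b ^ n) \<le> 2 * (g a * g b)" for a b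
  proof -
    have "norm (a ^ n - b ^ n) \<le> g a + g b"
      using norm_triangle_ineq4[of "a ^ n" "b ^ n"] g(2)[of a] g(2)[of b] by linarith
    moreover have "g a * 1 \<le> g a * g b" "1 * g b \<le> g a * g b"
      using g[of a] g[of b] by (intro mult_mono; simp)+
    ultimately show ?thesis by simp
  qed
  have "pair_prod (\<lambda>a b. norm (a ^ n - b ^ n)) A \<le> pair_prod (\<lambda>a b. 2 * (g a * g b)) A"
    using le by (intro pair_prod_mono) auto
  \<comment> \<open>The added diagonal factors are at least 1. In the completed square every
    \<open>g a\<close> occurs exactly \<open>2 * card A\<close> times.\<close>
  also have "\<dots> \<le> (\<Prod>a\<in>A. \<Prod>b\<in>A. 2 * (g a * g b))"
    unfolding pair_prod_def
  proof (intro prod_mono conjI prod_nonneg prod_mono2)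
    fix a b show "2 * (g a * g b) \<ge> 1"
      using mult_mono[OF g(1)[of a] g(1)[of b]] g(1)[of a] by simp
  qed (use A g(1) in \<open>auto intro!: mult_nonneg_nonneg simp: order.trans[OF zero_le_one]\<close>)
  also have "\<dots> = 2 ^ (card A)\<^sup>2 * ((\<Prod>a\<in>A. g a) ^ card A * (\<Prod>a\<in>A. g a) ^ card A)"
    by (simp add: prod.distrib prod_power_distrib power_mult power2_eq_square)
  also have "(\<Prod>a\<in>A. g a) = (\<Prod>a\<in>A. max 1 (norm a)) ^ n"
    by (simp add: g_def prod_power_distrib)
  also have "(\<dots> ^ card A * \<dots> ^ card A) = (\<Prod>a\<in>A. max 1 (norm a)) ^ (2 * n * card A)"
    by (simp only: mult_2 distrib_right power_add power_mult)
  finally show ?thesis .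
qed

text \<open>The estimate is first proved for the full square over the nonzero elements, whose
  diagonal contributes \<open>s\<close>. Removing the diagonal costs one power of \<open>M\<close>
  if 0 is not in \<open>A\<close>; otherwise the pairs containing 0 make up for it, and
  \<open>B\<close> has just \<open>card A - 1\<close> elements.\<close>

lemma pair_prod_max_ge:
  assumes A: "finite A" and ge1: "(\<Prod>a\<in>A - {0}. norm a) \<ge> 1"
  shows "pair_prod (\<lambda>a b. max (norm a) (norm b)) A \<ge> (\<Prod>a\<in>A. max 1 (norm a)) ^ (card A - 1)"
proof -
  define B where "B = A - {0}"
  define s where "s = (\<Prod>a\<in>B. norm a)"
  define M where "M = (\<Prod>a\<in>A. max 1 (norm a))"
  have B: "finite B" "0 \<notin> B" and s: "s \<ge> 1"
    using A ge1 by (auto simp: B_def s_def)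
  have M_B: "M = (\<Prod>a\<in>B. max 1 (norm a))"
    unfolding M_def B_def using A by (intro prod.mono_neutral_right) auto
  have key: "(\<Prod>b\<in>B. max (norm a) (norm b)) \<ge> max 1 (norm a) ^ card B" for a :: complex
  proof -
    have "(\<Prod>b\<in>B. norm a) \<le> (\<Prod>b\<in>B. max (norm a) (norm b))"
      by (intro prod_mono) auto
    moreover have "s \<le> (\<Prod>b\<in>B. max (norm a) (norm b))"
      unfolding s_def by (intro prod_mono) auto
    ultimately show ?thesis using s by (auto simp: max_def)
  qed
  have T_B: "M ^ card B \<le> pair_prod (\<lambda>a b. max (norm a) (norm b)) B * s"
  proof -
    have "M ^ card B = (\<Prod>a\<in>B. max 1 (norm a) ^ card B)"
      by (simp add: M_B prod_power_distrib)
    also have "\<dots> \<le> (\<Prod>a\<in>B. \<Prod>b\<in>B. max (norm a) (norm b))"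
      using key by (intro prod_mono) auto
    also have "\<dots> = (\<Prod>a\<in>B. norm a * (\<Prod>b\<in>B - {a}. max (norm a) (norm b)))"
      using B by (intro prod.cong refl, subst prod.remove) auto
    finally show ?thesis by (simp add: prod.distrib s_def pair_prod_def mult.commute)
  qed
  show ?thesis
  proof (cases "0 \<in> A")
    case False
    hence [simp]: "B = A" by (auto simp: B_def)
    show ?thesis
    proof (cases "A = {}")
      case False
      \<comment> \<open>The diagonal product \<open>s\<close> can be cancelled against a single
        factor \<open>M\<close>.\<close>
      have "s \<le> M"
        unfolding s_def M_B by (intro prod_mono) auto
      have "s * M ^ (card A - 1) \<le> M * M ^ (card A - 1)"
        using \<open>s \<le> M\<close> s by (intro mult_right_mono) auto
      also have "\<dots> = M ^ card A"
        using False A by (simp flip: power_Suc add: card_gt_0_iff)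
      also have "\<dots> \<le> pair_prod (\<lambda>a b. max (norm a) (norm b)) A * s"
        using T_B by simp
      finally show ?thesis using s by (simp add: M_def mult.commute)
    qed (simp add: pair_prod_def)
  next
    case True
    have A_eq: "A = insert 0 B" and card: "card A - 1 = card B"
      using True A by (auto simp: B_def)
    \<comment> \<open>The pairs containing 0 contribute each \<open>norm b\<close> once in either
      order, hence \<open>s\<close> twice: one copy restores the diagonal of \<open>B\<close>, the
      other is at least 1.\<close>
    have "pair_prod (\<lambda>a b. max (norm a) (norm b)) A
            = (\<Prod>b\<in>B. norm b) * (\<Prod>a\<in>B. \<Prod>b\<in>insert 0 (B - {a}). max (norm a) (norm b))"
      unfolding pair_prod_def A_eq using B
      by (subst prod.insert) (auto intro!: arg_cong2[of _ _ _ _ "(*)"] prod.cong simp: max_def insert_Diff_if)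
    also have "\<dots> = s * (s * pair_prod (\<lambda>a b. max (norm a) (norm b)) B)"
    proof -
      have "(\<Prod>b\<in>insert 0 (B - {a}). max (norm a) (norm b))
              = norm a * (\<Prod>b\<in>B - {a}. max (norm a) (norm b))" for a
        using B by (subst prod.insert) auto
      thus ?thesis by (simp add: s_def pair_prod_def prod.distrib)
    qed
    also have "\<dots> \<ge> 1 * (s * pair_prod (\<lambda>a b. max (norm a) (norm b)) B)"
      using s by (intro mult_right_mono) (auto simp: pair_prod_def le_max_iff_disj intro!: mult_nonneg_nonneg prod_nonneg)
    finally show ?thesis
      using T_B unfolding card M_def[symmetric] by (simp add: mult.commute)
  qed
qed

lemma prod_offdiag_reindex:
  assumes h: "bij_betw h I A"
  shows "(\<Prod>i\<in>I. \<Prod>j\<in>I - {i}. f (h i) (h j)) = (\<Prod>a\<in>A. \<Prod>b\<in>A - {a}. f a b)"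
proof -
  have "(\<Prod>j\<in>I - {i}. f (h i) (h j)) = (\<Prod>b\<in>A - {h i}. f (h i) b)" if "i \<in> I" for i
  proof (rule prod.reindex_bij_betw)
    show "bij_betw h (I - {i}) (A - {h i})"
      using h that by (auto simp: bij_betw_def inj_on_def)
  qed
  hence "(\<Prod>i\<in>I. \<Prod>j\<in>I - {i}. f (h i) (h j)) = (\<Prod>i\<in>I. \<Prod>b\<in>A - {h i}. f (h i) b)"
    by (intro prod.cong) auto
  also have "\<dots> = (\<Prod>a\<in>A. \<Prod>b\<in>A - {a}. f a b)"
    using h by (rule prod.reindex_bij_betw)
  finally show ?thesis .
qed

text \<open>By symmetry, the two factors of each square can be assigned to the two orders of the
  index pair.\<close>

lemma prod_lessThan_symmetric:
  fixes f :: "nat \<Rightarrow> nat \<Rightarrow> 'a::comm_monoid_mult"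
  assumes sym: "\<And>i j. f i j = f j i"
  shows "(\<Prod>k<n. \<Prod>j<k. (f j k)\<^sup>2) = (\<Prod>i<n. \<Prod>j\<in>{..<n} - {i}. f i j)"
proof (induction n)
  case (Suc n)
  have "(\<Prod>j\<in>{..<Suc n} - {i}. f i j) = f i n * (\<Prod>j\<in>{..<n} - {i}. f i j)" if "i < n" for i
  proof -
    have "{..<Suc n} - {i} = insert n ({..<n} - {i})" using that by auto
    thus ?thesis by simp
  qed
  moreover have "{..<Suc n} - {n} = {..<n}" by auto
  ultimately have "(\<Prod>i<Suc n. \<Prod>j\<in>{..<Suc n} - {i}. f i j)
      = (\<Prod>i<n. f i n) * (\<Prod>i<n. \<Prod>j\<in>{..<n} - {i}. f i j) * (\<Prod>j<n. f n j)"
    by (simp add: prod.distrib)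
  also have "(\<Prod>j<n. f n j) = (\<Prod>j<n. f j n)"
    using sym by (intro prod.cong) auto
  finally show ?case
    using Suc by (simp add: power2_eq_square prod.distrib ac_simps)
qed simp

section \<open>Roots of squarefree integer polynomials\<close>

text \<open>Powers of distinct roots may coincide, so the product is indexed by the roots of
  \<open>P\<close> rather than by their powers. The list of roots of
  \<open>power_roots_poly P n\<close> agrees with the list of powers only up to a permutation, which
  the product over ordered pairs does not see.\<close>

lemma norm_monic_discriminant_power_roots_poly:
  assumes dist: "distinct (complex_roots_int P)"
  shows "norm (monic_discriminant (power_roots_poly P n))
           = pair_prod (\<lambda>a b. norm (a ^ n - b ^ n)) (set (complex_roots_int P))"
proof -
  define \<alpha> where "\<alpha> = complex_roots_int P"
  define p where "p = power_roots_poly P n"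
  define \<beta> where "\<beta> = complex_roots_complex p"
  have p: "p = (\<Prod>a\<leftarrow>map (\<lambda>a. a ^ n) \<alpha>. [:- a, 1:])"
    by (simp add: p_def power_roots_poly_def \<alpha>_def o_def)
  have "lead_coeff p = 1"
    unfolding p lead_coeff_of_prod by (induction \<alpha>) auto
  hence "(\<Prod>a\<leftarrow>\<beta>. [:- a, 1:]) = (\<Prod>a\<leftarrow>map (\<lambda>a. a ^ n) \<alpha>. [:- a, 1:])"
    using complex_roots(1)[of p] p by (simp add: \<beta>_def)
  hence "mset \<beta> = mset (map (\<lambda>a. a ^ n) \<alpha>)"
    by (rule reconstruct_poly_monic_defines_mset)
  then obtain \<pi> where "\<pi> permutes {..<length (map (\<lambda>a. a ^ n) \<alpha>)}"
      and \<beta>_eq: "permute_list \<pi> (map (\<lambda>a. a ^ n) \<alpha>) = \<beta>"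
    by (rule mset_eq_permutation)
  hence \<pi>: "\<pi> permutes {..<length \<alpha>}" by simp
  have len: "length \<beta> = length \<alpha>"
    using \<beta>_eq by auto
  have nth: "\<beta> ! i = (\<alpha> ! \<pi> i) ^ n" if "i < length \<alpha>" for i
    using that \<pi> permutes_in_image[OF \<pi>, of i] unfolding \<beta>_eq[symmetric]
    by (subst permute_list_nth) auto
  have bij: "bij_betw (\<lambda>i. \<alpha> ! \<pi> i) {..<length \<alpha>} (set \<alpha>)"
    using bij_betw_trans[OF permutes_imp_bij[OF \<pi>] bij_betw_nth[OF dist[folded \<alpha>_def] refl refl]]
    by (simp add: o_def)
  have "norm (monic_discriminant p) = (\<Prod>k<length \<alpha>. \<Prod>j<k. (norm (\<beta> ! j - \<beta> ! k))\<^sup>2)"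
    by (simp add: monic_discriminant_def Let_def len norm_power flip: \<beta>_def prod_norm)
  also have "\<dots> = (\<Prod>i<length \<alpha>. \<Prod>j\<in>{..<length \<alpha>} - {i}. norm (\<beta> ! i - \<beta> ! j))"
    by (rule prod_lessThan_symmetric) (rule norm_minus_commute)
  also have "\<dots> = (\<Prod>i<length \<alpha>. \<Prod>j\<in>{..<length \<alpha>} - {i}. norm ((\<alpha> ! \<pi> i) ^ n - (\<alpha> ! \<pi> j) ^ n))"
    by (intro prod.cong) (auto simp: nth)
  also have "\<dots> = pair_prod (\<lambda>a b. norm (a ^ n - b ^ n)) (set \<alpha>)"
    unfolding pair_prod_def using prod_offdiag_reindex[OF bij, of "\<lambda>a b. norm (a ^ n - b ^ n)"] by simp
  finally show ?thesis by (simp add: p_def \<alpha>_def)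
qed

lemma poly_eq_prod_complex_roots_int:
  assumes "monic P"
  shows "(of_int_poly P :: complex poly) = (\<Prod>a\<leftarrow>complex_roots_int P. [:- a, 1:])"
  using complex_roots_int(1)[of P] assms by simp

text \<open>The number of different roots equals the degree, which is also the length of the
  list.\<close>

lemma distinct_complex_roots_int:
  assumes "monic P" "rsquarefree (of_int_poly P :: complex poly)"
  shows "distinct (complex_roots_int P)"
proof -
  have "{x. poly (of_int_poly P) x = 0} = set (complex_roots_int P)"
    unfolding poly_eq_prod_complex_roots_int[OF assms(1)]
    by (auto simp: poly_prod_list prod_list_zero_iff)
  moreover have "card {x. poly (of_int_poly P) x = (0::complex)} = degree P"
    using assms(2) rsquarefree_card_degree[of "of_int_poly P"] by (simp add: rsquarefree_def)
  ultimately show ?thesis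
    by (intro card_distinct) (simp add: complex_roots_int(2))
qed

lemma mahler_measure_eq_prod_roots:
  assumes "monic P" "distinct (complex_roots_int P)"
  shows "mahler_measure P = (\<Prod>a\<in>set (complex_roots_int P). max 1 (norm a))"
  using assms
  by (simp add: mahler_measure_def mahler_measure_poly_def prod.distinct_set_conv_list complex_roots_int_def)

text \<open>The product is the absolute value of a nonzero coefficient of \<open>P\<close>, namely that of 1 or \<open>x\<close>.\<close>
lemma prod_nonzero_roots_ge_1:
  assumes monic: "monic P" and dist: "distinct (complex_roots_int P)"
  shows "(\<Prod>a\<in>set (complex_roots_int P) - {0}. norm a) \<ge> 1"
proof -
  define A where "A = set (complex_roots_int P)"
  define Q where "Q = (\<Prod>a\<in>A - {0}. [:- a, 1:])"
  have P: "of_int_poly P = (\<Prod>a\<in>A. [:- a, 1:])"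
    unfolding poly_eq_prod_complex_roots_int[OF monic] A_def
    by (simp add: prod.distinct_set_conv_list[OF dist])
  have Q0: "Polynomial.coeff Q 0 = (\<Prod>a\<in>A - {0}. - a)"
    by (simp add: Q_def poly_0_coeff_0[symmetric] poly_prod)
  obtain k where k: "Polynomial.coeff Q 0 = of_int k"
  proof (cases "0 \<in> A")
    case True
    have "of_int_poly P = [:0, 1:] * Q"
      unfolding P Q_def using True by (subst prod.remove[of A 0]) (auto simp: A_def)
    hence "Polynomial.coeff (of_int_poly P) (Suc 0) = Polynomial.coeff Q 0"
      by simp
    thus ?thesis using that[of "Polynomial.coeff P (Suc 0)"] by simp
  next
    case False
    hence "of_int_poly P = Q"
      by (simp add: P Q_def)
    thus ?thesis using that[of "Polynomial.coeff P 0"] by (metis coeff_map_poly of_int_0)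
  qed
  have "norm (Polynomial.coeff Q 0) = (\<Prod>a\<in>A - {0}. norm a)"
    unfolding Q0 by (simp flip: prod_norm)
  moreover have "Polynomial.coeff Q 0 \<noteq> 0"
    unfolding Q0 by (auto simp: A_def)
  ultimately have "real_of_int \<bar>k\<bar> = (\<Prod>a\<in>A - {0}. norm a)" "k \<noteq> 0"
    by (auto simp: k)
  thus ?thesis unfolding A_def by linarith
qed

section \<open>Upper and lower bounds for the upper limit in terms of the Mahler measure\<close>

lemma limsup_discriminant_le:
  assumes monic: "monic P" and dist: "distinct (complex_roots_int P)" and deg: "degree P > 0"
  shows "limsup (\<lambda>n. ereal (norm (monic_discriminant (power_roots_poly P n))
                              powr (1 / (real n * real (degree P))))) \<le> ereal ((mahler_measure P)\<^sup>2)"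
proof -
  define A where "A = set (complex_roots_int P)"
  define d where "d = degree P"
  define M where "M = mahler_measure P"
  define D where "D = (\<lambda>n. norm (monic_discriminant (power_roots_poly P n)))"
  have A: "finite A" "card A = d"
    using dist by (auto simp: A_def d_def distinct_card complex_roots_int(2))
  have M: "M = (\<Prod>a\<in>A. max 1 (norm a))" "M > 0"
    using mahler_measure_eq_prod_roots[OF monic dist]
    by (auto simp: M_def A_def intro!: prod_pos)
  have D_nonneg: "0 \<le> D n" for n
    by (simp add: D_def)
  have D_le: "D n \<le> 2 ^ d\<^sup>2 * M ^ (2 * n * d)" for n
    using pair_prod_power_differences_le[OF A(1), of n] norm_monic_discriminant_power_roots_poly[OF dist, of n]
    by (simp only: D_def A_def[symmetric] A(2) M(1)[symmetric])
  \<comment> \<open>Taking the root of order \<open>n * d\<close> turns \<open>2 ^ d\<^sup>2\<close>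
    into \<open>2 powr (d / n)\<close>, which tends to 1, and leaves \<open>M\<^sup>2\<close> from
    the power of \<open>M\<close>.\<close>
  have bound: "D n powr (1 / (real n * real d)) \<le> 2 powr (real d / real n) * M\<^sup>2" if n: "n > 0" for n
  proof -
    have "D n powr (1 / (real n * real d)) \<le> (2 ^ d\<^sup>2 * M ^ (2 * n * d)) powr (1 / (real n * real d))"
      using D_nonneg D_le by (intro powr_mono2) auto
    also have "\<dots> = (2 powr (real d * real d) * M powr (2 * real n * real d)) powr (1 / (real n * real d))"
      using M(2) by (simp flip: powr_realpow add: power2_eq_square)
    also have "\<dots> = 2 powr (real d / real n) * M powr 2"
      using n deg M(2) by (simp add: powr_mult powr_powr d_def)
    finally show ?thesis using M(2) by simp
  qed
  have "limsup (\<lambda>n. ereal (D n powr (1 / (real n * real d))))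
          \<le> limsup (\<lambda>n. ereal (2 powr (real d / real n) * M\<^sup>2))"
    using bound by (intro Limsup_mono eventually_mono[OF eventually_gt_at_top[of 0]]) auto
  also have "\<dots> = ereal (2 powr 0 * M\<^sup>2)"
    by (intro lim_imp_Limsup tendsto_intros lim_const_over_n) auto
  finally show ?thesis by (simp add: D_def d_def M_def)
qed

text \<open>This fits a lower bound that holds only for infinitely many indices and reaches
  \<open>l\<close> only in the limit. A value strictly between the upper limit and \<open>l\<close>
  would eventually separate \<open>u\<close> from \<open>g\<close>.\<close>

lemma le_Limsup_if_frequently_ge:
  fixes u g :: "'a \<Rightarrow> ereal"
  assumes g: "(g \<longlongrightarrow> l) F" and freq: "frequently (\<lambda>x. g x \<le> u x) F"
  shows "l \<le> Limsup F u"
proof (rule ccontr)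
  assume "\<not> l \<le> Limsup F u"
  then obtain y where y: "Limsup F u < y" "y < l"
    by (meson dense not_le)
  have "eventually (\<lambda>x. u x < y) F" "eventually (\<lambda>x. g x > y) F"
    using Limsup_lessD[OF y(1)] order_tendstoD(1)[OF g y(2)] by auto
  hence "eventually (\<lambda>x. \<not> g x \<le> u x) F"
    by eventually_elim auto
  with freq show False by (simp add: frequently_def)
qed

lemma limsup_discriminant_ge:
  assumes monic: "monic P" and dist: "distinct (complex_roots_int P)" and deg: "degree P > 0"
  shows "limsup (\<lambda>n. ereal (norm (monic_discriminant (power_roots_poly P n))
                              powr (1 / (real n * real (degree P)))))
           \<ge> ereal (mahler_measure P powr ((real (degree P) - 1) / real (degree P)))"
proof -
  define A where "A = set (complex_roots_int P)"
  define d where "d = degree P"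
  define M where "M = mahler_measure P"
  define D where "D = (\<lambda>n. norm (monic_discriminant (power_roots_poly P n)))"
  define l where "l = M powr ((real d - 1) / real d)"
  have A: "finite A" "card A = d"
    using dist by (auto simp: A_def d_def distinct_card complex_roots_int(2))
  have M: "M = (\<Prod>a\<in>A. max 1 (norm a))" "M > 0"
    using mahler_measure_eq_prod_roots[OF monic dist]
    by (auto simp: M_def A_def intro!: prod_pos)
  obtain c where c: "c > 0"
    "\<And>B. \<exists>n\<ge>B. \<forall>a\<in>A. \<forall>b\<in>A - {a}. norm (a ^ n - b ^ n) \<ge> c * max (norm a) (norm b) ^ n"
    using power_differences_bounded_below[OF A(1)] by blast
  \<comment> \<open>The constant \<open>c\<close> does not depend on \<open>n\<close> and enters
    once for each of the \<open>d * (d - 1)\<close> ordered pairs. After the root of order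
    \<open>n * d\<close> its contribution tends to 1, while the power of \<open>M\<close> becomes
    \<open>l\<close>.\<close>
  have bound: "c powr ((real d - 1) / real n) * l \<le> D n powr (1 / (real n * real d))"
    if n: "n > 0" and *: "\<forall>a\<in>A. \<forall>b\<in>A - {a}. norm (a ^ n - b ^ n) \<ge> c * max (norm a) (norm b) ^ n" for n
  proof -
    have "c ^ (d * (d - 1)) * M ^ ((d - 1) * n)
            \<le> c ^ (d * (d - 1)) * pair_prod (\<lambda>a b. max (norm a) (norm b)) A ^ n"
      using pair_prod_max_ge[OF A(1)] prod_nonzero_roots_ge_1[OF monic dist] c(1) M
      unfolding power_mult[of M] A(2)[symmetric]
      by (intro mult_left_mono power_mono) (auto simp: A_def)
    also have "\<dots> = pair_prod (\<lambda>a b. c * max (norm a) (norm b) ^ n) A"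
      by (simp add: pair_prod_mult pair_prod_power pair_prod_const[OF A(1)] A(2))
    also have "\<dots> \<le> pair_prod (\<lambda>a b. norm (a ^ n - b ^ n)) A"
      using * c(1) by (intro pair_prod_mono) (auto simp: le_max_iff_disj)
    also have "\<dots> = D n"
      using norm_monic_discriminant_power_roots_poly[OF dist, of n] by (simp add: D_def A_def)
    finally have "(c ^ (d * (d - 1)) * M ^ ((d - 1) * n)) powr (1 / (real n * real d))
                    \<le> D n powr (1 / (real n * real d))"
      using c(1) M(2) by (intro powr_mono2) auto
    also have "c ^ (d * (d - 1)) * M ^ ((d - 1) * n)
        = c powr (real d * (real d - 1)) * M powr ((real d - 1) * real n)"
      using c(1) M(2) deg by (simp flip: powr_realpow add: of_nat_diff d_def)
    also have "\<dots> powr (1 / (real n * real d)) = c powr ((real d - 1) / real n) * l"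
      using n deg c(1) M(2) by (simp add: powr_mult powr_powr d_def l_def)
    finally show ?thesis .
  qed
  have "frequently (\<lambda>n. ereal (c powr ((real d - 1) / real n) * l)
                          \<le> ereal (D n powr (1 / (real n * real d)))) sequentially"
    unfolding frequently_sequentially
  proof
    fix N
    \<comment> \<open>Starting at \<open>Suc N\<close> ensures \<open>n > 0\<close>, as
      \<open>bound\<close> requires.\<close>
    obtain n where "n \<ge> Suc N" "\<forall>a\<in>A. \<forall>b\<in>A - {a}. norm (a ^ n - b ^ n) \<ge> c * max (norm a) (norm b) ^ n"
      using c(2) by blast
    thus "\<exists>n\<ge>N. ereal (c powr ((real d - 1) / real n) * l) \<le> ereal (D n powr (1 / (real n * real d)))"
      using bound[of n] by (intro exI[of _ n]) auto
  qed
  moreover have "(\<lambda>n. ereal (c powr ((real d - 1) / real n) * l)) \<longlonglongrightarrow> ereal (c powr 0 * l)"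
    using c(1) by (intro tendsto_intros lim_const_over_n) auto
  ultimately have "ereal (c powr 0 * l) \<le> limsup (\<lambda>n. ereal (D n powr (1 / (real n * real d))))"
    by (intro le_Limsup_if_frequently_ge)
  thus ?thesis using c(1) by (simp add: D_def d_def l_def M_def)
qed

section \<open>Irreducible factors of noncyclotomic polynomials\<close>

lemma cyclotomic_1: "cyclotomic 1"
  unfolding cyclotomic_def by (intro exI[of _ "[]"]) simp

lemma cyclotomic_mult:
  assumes "cyclotomic P" "cyclotomic Q"
  shows "cyclotomic (P * Q)"
proof -
  obtain ms ns where
    "\<forall>n\<in>set ms. n \<ge> 1" "of_int_poly P = (\<Prod>n\<leftarrow>ms. cyclotomic_poly n)"
    "\<forall>n\<in>set ns. n \<ge> 1" "of_int_poly Q = (\<Prod>n\<leftarrow>ns. cyclotomic_poly n)"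
    using assms by (auto simp: cyclotomic_def)
  thus ?thesis unfolding cyclotomic_def
    by (intro exI[of _ "ms @ ns"]) (auto simp: of_int_poly_hom.hom_mult)
qed

text \<open>Products of a power of \<open>x\<close> and a cyclotomic polynomial are closed under
  multiplication.\<close>

lemma noncyclotomic_mult:
  assumes "noncyclotomic (P * Q)"
  shows "noncyclotomic P \<or> noncyclotomic Q"
proof (rule ccontr)
  assume "\<not> ?thesis"
  then obtain j R k S where
    "cyclotomic R" "P = [:0, 1:] ^ j * R" "cyclotomic S" "Q = [:0, 1:] ^ k * S"
    by (auto simp: noncyclotomic_def)
  hence "P * Q = [:0, 1:] ^ (j + k) * (R * S)" "cyclotomic (R * S)"
    by (simp_all only: cyclotomic_mult power_add ac_simps)
  with assms show False unfolding noncyclotomic_def by blast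
qed

lemma not_noncyclotomic_1: "\<not> noncyclotomic 1"
  using cyclotomic_1 unfolding noncyclotomic_def by (metis mult_1 power_0)

lemma cyclotomic_poly_2: "cyclotomic_poly 2 = [:1, 1:]"
proof -
  have interval: "{1..<2} = {1::nat}" by auto
  have primitive: "z ^ 2 = 1 \<and> (\<forall>m\<in>{1..<2}. z ^ m \<noteq> 1) \<longleftrightarrow> z = - 1" for z :: complex
    unfolding interval
    by (auto simp only: ball_simps power_one_right power2_eq_1_iff insert_iff empty_iff) simp_all
  have "{z::complex. z ^ 2 = 1 \<and> (\<forall>m\<in>{1..<2}. z ^ m \<noteq> 1)} = {- 1}"
    unfolding primitive singleton_conv ..
  thus ?thesis unfolding cyclotomic_poly_def by simp
qed

text \<open>The constants of smaller absolute value give \<open>x\<close> and the first two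
  cyclotomic polynomials. Linear factors need this direct bound because the discriminant condition
  starts at degree 2.\<close>

lemma noncyclotomic_linear:
  assumes "noncyclotomic [:c, 1:]"
  shows "\<bar>c\<bar> \<ge> 2"
proof (rule ccontr)
  assume "\<not> ?thesis"
  then consider "c = 0" | "c = -1" | "c = 1" by linarith
  thus False
  proof cases
    case 1
    have "[:c, 1:] = [:0, 1:] ^ 1 * 1" using 1 by simp
    with assms cyclotomic_1 show False unfolding noncyclotomic_def by blast
  next
    case 2
    have "{z::complex. z ^ 1 = 1 \<and> (\<forall>m\<in>{1..<1}. z ^ m \<noteq> 1)} = {1}" by auto
    hence "cyclotomic_poly 1 = [:- 1, 1:]" by (simp add: cyclotomic_poly_def)
    hence "cyclotomic [:c, 1:]"
      unfolding cyclotomic_def using 2 by (intro exI[of _ "[1]"]) simp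
    moreover have "[:c, 1:] = [:0, 1:] ^ 0 * [:c, 1:]" by simp
    ultimately show False using assms unfolding noncyclotomic_def by blast
  next
    case 3
    have "cyclotomic [:c, 1:]"
      unfolding cyclotomic_def
    proof (intro exI conjI)
      show "\<forall>n\<in>set [2]. 1 \<le> (n::nat)" by simp
      show "of_int_poly [:c, 1:] = (\<Prod>n\<leftarrow>[2]. cyclotomic_poly n)"
        unfolding 3 by (simp add: cyclotomic_poly_2)
    qed
    moreover have "[:c, 1:] = [:0, 1:] ^ 0 * [:c, 1:]" by simp
    ultimately show False using assms unfolding noncyclotomic_def by blast
  qed
qed

text \<open>The leading coefficients are inverse units of the integers, so both are 1 or both are
  -1; in the latter case both factors change sign.\<close>

lemma monic_mult_int_cases:
  fixes q r :: "int poly"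
  assumes "monic (q * r)"
  obtains q' r' where "monic q'" "monic r'" "q * r = q' * r'" "degree q' = degree q" "degree r' = degree r"
proof -
  have "lead_coeff q * lead_coeff r = 1"
    using assms by (simp add: lead_coeff_mult)
  then consider "lead_coeff q = 1" "lead_coeff r = 1" | "lead_coeff q = -1" "lead_coeff r = -1"
    using zmult_eq_1_iff[of "lead_coeff q" "lead_coeff r"] by auto
  thus ?thesis
    by cases (use that[of q r] that[of "- q" "- r"] in auto)
qed

text \<open>Induction on the degree: a reducible polynomial splits into monic factors of smaller
  degree, and at least one of them is again noncyclotomic.\<close>

lemma noncyclotomic_irreducible_factor:
  assumes "monic P" "noncyclotomic P"
  shows "\<exists>f. monic f \<and> noncyclotomic f \<and> irreducible\<^sub>d f \<and> f dvd P"
  using assms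
proof (induction "degree P" arbitrary: P rule: less_induct)
  case less
  show ?case
  proof (cases "irreducible\<^sub>d P")
    case True
    thus ?thesis using less.prems by auto
  next
    case False
    moreover have "degree P \<noteq> 0"
      using less.prems not_noncyclotomic_1 by (metis monic_degree_0)
    ultimately obtain q r where qr: "degree q < degree P" "degree r < degree P" "P = q * r"
      by (elim reducible\<^sub>dE) auto
    obtain q' r' where *: "monic q'" "monic r'" "q * r = q' * r'" "degree q' = degree q" "degree r' = degree r"
      using monic_mult_int_cases[of q r] less.prems(1) qr(3) by metis
    hence "noncyclotomic q' \<or> noncyclotomic r'"
      using noncyclotomic_mult[of q' r'] less.prems(2) qr(3) by simp
    thus ?thesis
      using less.hyps[of q'] less.hyps[of r'] * qr by (metis dvd_mult dvd_mult2)
  qed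
qed

text \<open>Irreducibility may be lost over the complex numbers, but square-freeness is not: in
  characteristic 0 it means coprimality with the derivative, which field embeddings
  preserve.\<close>

lemma irreducible_imp_rsquarefree_complex:
  fixes f :: "int poly"
  assumes "irreducible\<^sub>d f"
  shows "rsquarefree (of_int_poly f :: complex poly)"
proof -
  interpret hom: field_hom_0' "of_rat :: rat \<Rightarrow> complex"
    ..
  have "square_free (of_int_poly f :: rat poly)"
    by (intro square_free_int_rat irreducible\<^sub>d_square_free assms)
  hence "square_free (map_poly (of_rat :: rat \<Rightarrow> complex) (of_int_poly f))"
    by (simp only: hom.square_free_map_poly)
  also have "map_poly (of_rat :: rat \<Rightarrow> complex) (of_int_poly f) = of_int_poly f"
    by (intro poly_eqI) (simp add: coeff_map_poly)
  finally show ?thesis by (rule square_free_rsquarefree)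
qed

section \<open>Equivalence of the bounds for Mahler measures and for discriminants\<close>

theorem theorem6p7:
  shows
    "(\<exists>C::real. C > 1 \<and>
        (\<forall>P::int poly. monic P \<longrightarrow> noncyclotomic P \<longrightarrow> mahler_measure P \<ge> C))
     \<longleftrightarrow>
     (\<exists>C::real. C > 1 \<and>
        (\<forall>P::int poly. monic P \<longrightarrow> noncyclotomic P \<longrightarrow>
           rsquarefree (map_poly of_int P :: complex poly) \<longrightarrow> degree P \<ge> 2 \<longrightarrow>
           limsup (\<lambda>n. ereal (cmod (monic_discriminant (power_roots_poly P n))
                                powr (1 / (real n * real (degree P))))) \<ge> ereal C))"
    (is "(\<exists>C>1. ?lehmer C) \<longleftrightarrow> (\<exists>C>1. ?disc C)")
proof (intro iffI; elim exE conjE)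
  fix C :: real assume C: "C > 1" and lehmer: "?lehmer C"
  \<comment> \<open>From degree 2 on the exponent \<open>(d - 1) / d\<close> is at least
    \<open>1 / 2\<close>, which explains the square root.\<close>
  have "?disc (sqrt C)"
  proof (intro allI impI)
    fix P :: "int poly"
    assume P: "monic P" "noncyclotomic P" "rsquarefree (of_int_poly P :: complex poly)" "degree P \<ge> 2"
    have M: "mahler_measure P \<ge> C" using lehmer P by blast
    have "sqrt C \<le> mahler_measure P powr (1 / 2)"
      using M C by (simp add: powr_half_sqrt)
    also have "\<dots> \<le> mahler_measure P powr ((real (degree P) - 1) / real (degree P))"
      using M C P(4) by (intro powr_mono) (auto simp: field_simps)
    finally show "ereal (sqrt C) \<le> limsup (\<lambda>n. ereal (cmod (monic_discriminant (power_roots_poly P n))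
                                powr (1 / (real n * real (degree P)))))"
      using P(4)
      by (intro order.trans[OF _ limsup_discriminant_ge[OF P(1) distinct_complex_roots_int[OF P(1,3)]]]) auto
  qed
  thus "\<exists>C>1. ?disc C" using C by (intro exI[of _ "sqrt C"]) auto
next
  fix C :: real assume C: "C > 1" and disc: "?disc C"
  \<comment> \<open>The value 2 accounts for linear irreducible factors; \<open>sqrt C\<close>
    results from \<open>C \<le> (mahler_measure f)\<^sup>2\<close> for the others.\<close>
  have "?lehmer (min 2 (sqrt C))"
  proof (intro allI impI)
    fix P :: "int poly"
    assume "monic P" "noncyclotomic P"
    then obtain f where f: "monic f" "noncyclotomic f" "irreducible\<^sub>d f" "f dvd P"
      using noncyclotomic_irreducible_factor by blast
    have "min 2 (sqrt C) \<le> mahler_measure f"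
    proof (cases "degree f \<ge> 2")
      case True
      have "rsquarefree (of_int_poly f :: complex poly)"
        using f(3) by (rule irreducible_imp_rsquarefree_complex)
      hence "ereal C \<le> ereal ((mahler_measure f)\<^sup>2)"
        using disc f True distinct_complex_roots_int[OF f(1)] limsup_discriminant_le[OF f(1)]
        by (meson order.trans less_le_trans pos2)
      hence "sqrt C \<le> mahler_measure f"
        by (simp add: real_le_lsqrt mahler_measure_ge_0)
      thus ?thesis by simp
    next
      case False
      moreover have "degree f > 0" using f(3) by auto
      ultimately have deg: "degree f = 1" by simp
      then obtain c where c: "f = [:c, 1:]"
        using f(1) by (metis degree1_coeffs One_nat_def coeff_pCons_0 coeff_pCons_Suc)
      have "of_int_poly f = ([:- (- of_int c), 1:] :: complex poly)"
        by (simp add: c)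
      hence "mahler_measure f = max 1 (norm (- of_int c :: complex))"
        unfolding mahler_measure_def using mahler_measure_factor[of "- of_int c"] by simp
      also have "\<dots> \<ge> 2"
        using noncyclotomic_linear[of c] f(2) by (simp add: c)
      finally show ?thesis by simp
    qed
    \<comment> \<open>The Mahler measure is multiplicative, and the cofactor of \<open>f\<close>, a
      nonzero integer polynomial, has measure at least 1.\<close>
    also have "\<dots> \<le> mahler_measure P"
      using f(4) \<open>monic P\<close> by (intro mahler_measure_dvd) auto
    finally show "min 2 (sqrt C) \<le> mahler_measure P" .
  qed
  thus "\<exists>C>1. ?lehmer C" using C by (intro exI[of _ "min 2 (sqrt C)"]) auto
qed

end
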